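(* Let $\Lambda$ be a set, let $(H_\lambda)_{\lambda\in\Lambda}$ be a family of commutative cancellative monoids, let $H=\prod_{\lambda\in\Lambda}H_\lambda$, and let $H^*=\prod^{\mathcal U}_{\lambda\in\Lambda}H_\lambda$ be the ultraproduct with respect to an ultrafilter $\mathcal U$ on $\Lambda$. Let $r=(r_\lambda)_{\lambda\in\Lambda}\in H$ with class $r^*\in H^*$, let $\ell\in\mathbb N_0$ and $n\in\mathbb N_0$. Then: (1) $\#_{L(r^* )}(\ell)=n$ if and only if $\{\lambda\in\Lambda\mid \#_{L(r_\lambda)}(\ell)=n\}\in\mathcal U$. (2) $\#_{L(r^* )}(\ell)=\infty$ if and only if $\{\lambda\in\Lambda\mid \#_{L(r_\lambda)}(\ell)>m\}\in\mathcal U$ for all $m\in\mathbb N$.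
   Context: For a commutative cancellative monoid $M$ (written multiplicatively), $M^\times$ is its group of units. An atom of $M$ is a non-unit $a$ such that $a=bc$ with $b,c\in M$ implies $b\in M^\times$ or $c\in M^\times$. Elements $a,b$ are associated if $a=\varepsilon b$ for some $\varepsilon\in M^\times$. A factorization of $a\in M$ of length $\ell\in\mathbb N_0$ is an expression $a=u_1\cdots u_\ell$ with atoms $u_i$ (for a unit $a$, the empty factorization of length $0$ is allowed: factorizations are considered up to units). Two factorizations $u_1\cdots u_n$ and $v_1\cdots v_m$ are essentially the same if $n=m$ and, for some permutation $\sigma$, $u_i$ is associated to $v_{\sigma(i)}$ for all $i$. For $a\in M$, $L(a)$ is the multiset of lengths of $a$: for $\ell\in\mathbb N_0$, the multiplicity $\#_{L(a)}(\ell)$ is the cardinality of the set of classes, modulo being essentially the same, of factorizations of $a$ of length $\ell$. One writes $\#_{L(a)}(\ell)=\infty$ if and only if this cardinal is infinite. The ultraproduct $H^*$ is the quotient of $H=\prod_\lambda H_\lambda$ by the relation $r\equiv s\iff\{\lambda\mid r_\lambda=s_\lambda\}\in\mathcal U$, with componentwise multiplication; it is again a commutative cancellative monoid. $r^*$ denotes the class of $r$. *)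

theory Defs
  imports
    "HOL-Algebra.Divisibility"
    "HOL-Algebra.Product_Groups"
    "HOL-Library.Extended_Nat"
begin

section \<open>Multisets of lengths\<close>

text \<open>
  Atoms, associated elements and essentially equal factorizations are the library's
  \<open>irreducible\<close>, \<open>associated\<close> and \<open>essentially_equal\<close>. The following three lemmas show
  that in a commutative cancellative monoid they have their usual element-wise meaning.
\<close>

lemma (in comm_monoid_cancel) irreducible_iff_atom:
  assumes a: "a \<in> carrier G"
  shows "irreducible G a \<longleftrightarrow>
    a \<notin> Units G \<and>
    (\<forall>b\<in>carrier G. \<forall>c\<in>carrier G. a = b \<otimes> c \<longrightarrow> b \<in> Units G \<or> c \<in> Units G)"
proof
  assume irr: "irreducible G a"
  then show "a \<notin> Units G \<and>
    (\<forall>b\<in>carrier G. \<forall>c\<in>carrier G. a = b \<otimes> c \<longrightarrow> b \<in> Units G \<or> c \<in> Units G)"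
    using irreducible_prodE by (auto simp: irreducible_def)
next
  assume R: "a \<notin> Units G \<and>
    (\<forall>b\<in>carrier G. \<forall>c\<in>carrier G. a = b \<otimes> c \<longrightarrow> b \<in> Units G \<or> c \<in> Units G)"
  show "irreducible G a"
  proof (rule irreducibleI)
    show "a \<notin> Units G" using R by blast
    fix b assume b: "b \<in> carrier G" "properfactor G b a"
    then obtain c where c: "c \<in> carrier G" "a = b \<otimes> c"
      by (auto simp: properfactor_def factor_def)
    have "c \<notin> Units G"
      using b c a associatedI2'[of a b c] by (auto simp: properfactor_def associated_def)
    then show "b \<in> Units G" using R b c by blast
  qed
qed

lemma (in comm_monoid_cancel) associated_iff_unit_mult:
  assumes "a \<in> carrier G" "b \<in> carrier G"
  shows "a \<sim> b \<longleftrightarrow> (\<exists>e\<in>Units G. a = e \<otimes> b)"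
  using associated_iff[OF assms] assms by (metis Units_closed m_comm)

lemma (in comm_monoid_cancel) essentially_equal_iff_permutes:
  assumes "set us \<subseteq> carrier G" "set vs \<subseteq> carrier G"
  shows "essentially_equal G us vs \<longleftrightarrow>
    length us = length vs \<and>
    (\<exists>s. s permutes {..<length us} \<and> (\<forall>i<length us. us ! i \<sim> vs ! s i))"
proof
  assume "essentially_equal G us vs"
  then obtain ws where ws: "mset us = mset ws" and rel: "list_all2 (\<sim>) ws vs"
    by (auto simp: essentially_equal_def)
  have len: "length us = length ws" "length ws = length vs"
    using mset_eq_length[OF ws] list_all2_lengthD[OF rel] by auto
  obtain f where f: "f permutes {..<length ws}" "permute_list f ws = us"
    using mset_eq_permutation[OF ws] by auto
  have "us ! i \<sim> vs ! f i" if "i < length us" for i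
  proof -
    have "f i < length ws" using f(1) that len permutes_in_image[OF f(1), of i] by auto
    moreover have "us ! i = ws ! f i"
      using f that len permute_list_nth[of f ws i] by auto
    ultimately show ?thesis using rel by (auto simp: list_all2_conv_all_nth)
  qed
  then show "length us = length vs \<and>
    (\<exists>s. s permutes {..<length us} \<and> (\<forall>i<length us. us ! i \<sim> vs ! s i))"
    using f(1) len by auto
next
  assume R: "length us = length vs \<and>
    (\<exists>s. s permutes {..<length us} \<and> (\<forall>i<length us. us ! i \<sim> vs ! s i))"
  then obtain s where len: "length us = length vs" and s: "s permutes {..<length us}"
    and as: "\<And>i. i < length us \<Longrightarrow> us ! i \<sim> vs ! s i" by auto
  let ?t = "inv_into UNIV s"
  have t: "?t permutes {..<length us}" using s by (rule permutes_inv)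
  have "mset us = mset (permute_list ?t us)"
    using mset_permute_list[OF t] by simp
  moreover have "list_all2 (\<sim>) (permute_list ?t us) vs"
    unfolding list_all2_conv_all_nth
  proof (intro conjI allI impI)
    show "length (permute_list ?t us) = length vs" using len by simp
    fix i assume "i < length (permute_list ?t us)"
    then have i: "i < length us" by simp
    have "?t i < length us" using i permutes_in_image[OF t, of i] by auto
    from as[OF this] show "permute_list ?t us ! i \<sim> vs ! i"
      using i t permute_list_nth[OF t, of i] permutes_inverses(1)[OF s, of i] by simp
  qed
  ultimately show "essentially_equal G us vs"
    by (auto simp: essentially_equal_def)
qed

text \<open>
  Since \<open>factors M [] a\<close> means \<open>a = \<one>\<close>, the second disjunct is what supplies
  the empty factorization of an arbitrary unit.
\<close>

definition factorizations :: "('a, 'm) monoid_scheme \<Rightarrow> 'a \<Rightarrow> nat \<Rightarrow> 'a list set" where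
  "factorizations M a l =
     {us. set us \<subseteq> carrier M \<and> length us = l \<and> (factors M us a \<or> us = [] \<and> a \<in> Units M)}"

definition factorization_classes ::
    "('a, 'm) monoid_scheme \<Rightarrow> 'a \<Rightarrow> nat \<Rightarrow> 'a list set set" where
  "factorization_classes M a l =
     factorizations M a l //
       {(us, vs). us \<in> factorizations M a l \<and> vs \<in> factorizations M a l \<and>
                  essentially_equal M us vs}"

lemma (in comm_monoid_cancel) equiv_essentially_equal:
  "equiv (factorizations G a l)
     {(us, vs). us \<in> factorizations G a l \<and> vs \<in> factorizations G a l \<and>
                essentially_equal G us vs}"
proof (rule equivI)
  show "refl_on (factorizations G a l) {(us, vs). us \<in> factorizations G a l \<and>
      vs \<in> factorizations G a l \<and> essentially_equal G us vs}"
    by (auto simp: refl_on_def factorizations_def intro: ee_refl)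
  show "sym {(us, vs). us \<in> factorizations G a l \<and>
      vs \<in> factorizations G a l \<and> essentially_equal G us vs}"
    by (auto simp: sym_def factorizations_def intro: ee_sym)
  show "trans {(us, vs). us \<in> factorizations G a l \<and>
      vs \<in> factorizations G a l \<and> essentially_equal G us vs}"
    by (auto simp: trans_def factorizations_def intro: ee_trans)
qed auto

text \<open>
  The multiset of lengths of \<open>a\<close>, given by its multiplicity function. A library
  multiset would not do, as multiplicities may be infinite.
\<close>

definition lengths :: "('a, 'm) monoid_scheme \<Rightarrow> 'a \<Rightarrow> nat \<Rightarrow> enat" where
  "lengths M a l =
     (if finite (factorization_classes M a l)
      then enat (card (factorization_classes M a l)) else \<infinity>)"


section \<open>Ultraproducts of monoids\<close>

definition ultrafilter_on :: "'i set \<Rightarrow> 'i set set \<Rightarrow> bool" where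
  "ultrafilter_on I U \<longleftrightarrow>
     U \<subseteq> Pow I \<and> I \<in> U \<and> {} \<notin> U \<and>
     (\<forall>A\<in>U. \<forall>B\<in>U. A \<inter> B \<in> U) \<and>
     (\<forall>A\<in>U. \<forall>B. A \<subseteq> B \<and> B \<subseteq> I \<longrightarrow> B \<in> U) \<and>
     (\<forall>A. A \<subseteq> I \<longrightarrow> A \<in> U \<or> I - A \<in> U)"

text \<open>
  Despite its name, \<open>product_group I H\<close> is the direct product of an arbitrary family of
  monoids; its elements are the extensional choice functions on \<open>I\<close>.
\<close>

definition ultra_rel ::
    "'i set \<Rightarrow> 'i set set \<Rightarrow> ('i \<Rightarrow> ('a, 'm) monoid_scheme) \<Rightarrow> (('i \<Rightarrow> 'a) \<times> ('i \<Rightarrow> 'a)) set" where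
  "ultra_rel I U H =
     {(r, s). r \<in> carrier (product_group I H) \<and> s \<in> carrier (product_group I H) \<and>
              {i \<in> I. r i = s i} \<in> U}"

definition ultra_class ::
    "'i set \<Rightarrow> 'i set set \<Rightarrow> ('i \<Rightarrow> ('a, 'm) monoid_scheme) \<Rightarrow> ('i \<Rightarrow> 'a) \<Rightarrow> ('i \<Rightarrow> 'a) set" where
  "ultra_class I U H r = ultra_rel I U H `` {r}"

text \<open>
  The union in the multiplication ranges over a family of equal classes; see
  \<open>ultraproduct_mult_class\<close> below.
\<close>

definition ultraproduct ::
    "'i set \<Rightarrow> 'i set set \<Rightarrow> ('i \<Rightarrow> ('a, 'm) monoid_scheme) \<Rightarrow> ('i \<Rightarrow> 'a) set monoid" where
  "ultraproduct I U H =
     \<lparr>carrier = carrier (product_group I H) // ultra_rel I U H,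
      mult = (\<lambda>A B. \<Union>a\<in>A. \<Union>b\<in>B. ultra_class I U H (a \<otimes>\<^bsub>product_group I H\<^esub> b)),
      one = ultra_class I U H \<one>\<^bsub>product_group I H\<^esub>\<rparr>"

lemma ultrafilter_on_mono:
  "ultrafilter_on I U \<Longrightarrow> A \<in> U \<Longrightarrow> A \<subseteq> B \<Longrightarrow> B \<subseteq> I \<Longrightarrow> B \<in> U"
  unfolding ultrafilter_on_def by blast

lemma ultrafilter_on_Int:
  "ultrafilter_on I U \<Longrightarrow> A \<in> U \<Longrightarrow> B \<in> U \<Longrightarrow> A \<inter> B \<in> U"
  unfolding ultrafilter_on_def by blast

lemma equiv_ultra_rel:
  assumes U: "ultrafilter_on I U"
  shows "equiv (carrier (product_group I H)) (ultra_rel I U H)"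
proof (rule equivI)
  show "ultra_rel I U H \<subseteq> carrier (product_group I H) \<times> carrier (product_group I H)"
    by (auto simp: ultra_rel_def)
  show "refl_on (carrier (product_group I H)) (ultra_rel I U H)"
    using U by (auto simp: refl_on_def ultra_rel_def ultrafilter_on_def)
  show "sym (ultra_rel I U H)"
    by (auto simp: sym_def ultra_rel_def eq_commute)
  show "trans (ultra_rel I U H)"
  proof (rule transI)
    fix r s t assume *: "(r, s) \<in> ultra_rel I U H" "(s, t) \<in> ultra_rel I U H"
    then have "{i \<in> I. r i = s i} \<inter> {i \<in> I. s i = t i} \<in> U"
      using ultrafilter_on_Int[OF U] by (auto simp: ultra_rel_def)
    then have "{i \<in> I. r i = t i} \<in> U"
      by (rule ultrafilter_on_mono[OF U]) auto
    then show "(r, t) \<in> ultra_rel I U H" using * by (auto simp: ultra_rel_def)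
  qed
qed

lemma ultra_class_eq_iff:
  assumes "ultrafilter_on I U"
    and "r \<in> carrier (product_group I H)" "s \<in> carrier (product_group I H)"
  shows "ultra_class I U H r = ultra_class I U H s \<longleftrightarrow> {i \<in> I. r i = s i} \<in> U"
  using eq_equiv_class_iff[OF equiv_ultra_rel[OF assms(1)] assms(2,3)] assms(2,3)
  by (auto simp: ultra_class_def ultra_rel_def)

lemma product_mult_closed:
  assumes H: "\<And>i. i \<in> I \<Longrightarrow> comm_monoid_cancel (H i)"
    and "r \<in> carrier (product_group I H)" "s \<in> carrier (product_group I H)"
  shows "r \<otimes>\<^bsub>product_group I H\<^esub> s \<in> carrier (product_group I H)"
  using assms(2,3)
  by (auto simp: PiE_iff intro!: monoid.m_closed
      comm_monoid.axioms(1)[OF comm_monoid_cancel.axioms(2)[OF H]])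

lemma ultraproduct_mult_class:
  assumes U: "ultrafilter_on I U"
    and H: "\<And>i. i \<in> I \<Longrightarrow> comm_monoid_cancel (H i)"
    and r: "r \<in> carrier (product_group I H)" and s: "s \<in> carrier (product_group I H)"
  shows "ultra_class I U H r \<otimes>\<^bsub>ultraproduct I U H\<^esub> ultra_class I U H s =
         ultra_class I U H (r \<otimes>\<^bsub>product_group I H\<^esub> s)"
proof -
  let ?P = "product_group I H"
  have eq: "ultra_class I U H (a \<otimes>\<^bsub>?P\<^esub> b) = ultra_class I U H (r \<otimes>\<^bsub>?P\<^esub> s)"
    if "a \<in> ultra_class I U H r" "b \<in> ultra_class I U H s" for a b
  proof -
    from that have ab: "a \<in> carrier ?P" "b \<in> carrier ?P"
      "{i \<in> I. r i = a i} \<in> U" "{i \<in> I. s i = b i} \<in> U"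
      by (auto simp: ultra_class_def ultra_rel_def)
    have "{i \<in> I. r i = a i} \<inter> {i \<in> I. s i = b i} \<in> U"
      by (rule ultrafilter_on_Int[OF U ab(3,4)])
    then have "{i \<in> I. (a \<otimes>\<^bsub>?P\<^esub> b) i = (r \<otimes>\<^bsub>?P\<^esub> s) i} \<in> U"
      by (rule ultrafilter_on_mono[OF U]) auto
    then show ?thesis
      using ultra_class_eq_iff[OF U product_mult_closed[OF H ab(1,2)] product_mult_closed[OF H r s]]
      by simp
  qed
  have mem: "r \<in> ultra_class I U H r" "s \<in> ultra_class I U H s"
    using r s equiv_class_self[OF equiv_ultra_rel[OF U]] by (auto simp: ultra_class_def)
  have "(\<Union>a\<in>ultra_class I U H r. \<Union>b\<in>ultra_class I U H s. ultra_class I U H (a \<otimes>\<^bsub>?P\<^esub> b))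
      = (\<Union>a\<in>ultra_class I U H r. \<Union>b\<in>ultra_class I U H s. ultra_class I U H (r \<otimes>\<^bsub>?P\<^esub> s))"
    using eq by (intro SUP_cong refl) blast
  also have "\<dots> = ultra_class I U H (r \<otimes>\<^bsub>?P\<^esub> s)" using mem by blast
  finally show ?thesis by (simp add: ultraproduct_def)
qed

lemma comm_monoid_cancel_ultraproduct:
  assumes U: "ultrafilter_on I U"
    and H: "\<And>i. i \<in> I \<Longrightarrow> comm_monoid_cancel (H i)"
  shows "comm_monoid_cancel (ultraproduct I U H)"
proof -
  let ?P = "product_group I H" and ?M = "ultraproduct I U H" and ?c = "ultra_class I U H"
  have mon: "monoid (H i)" if "i \<in> I" for i
    using H[OF that] by (simp add: comm_monoid_cancel_def comm_monoid_def)
  have com: "comm_monoid (H i)" if "i \<in> I" for i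
    using H[OF that] by (simp add: comm_monoid_cancel_def)
  have closed: "a \<otimes>\<^bsub>?P\<^esub> b \<in> carrier ?P" if "a \<in> carrier ?P" "b \<in> carrier ?P" for a b
    using H that by (rule product_mult_closed)
  have mult: "?c a \<otimes>\<^bsub>?M\<^esub> ?c b = ?c (a \<otimes>\<^bsub>?P\<^esub> b)"
    if "a \<in> carrier ?P" "b \<in> carrier ?P" for a b
    using U H that by (rule ultraproduct_mult_class)
  have carr: "carrier ?M = ?c ` carrier ?P"
    by (auto simp: ultraproduct_def quotient_def ultra_class_def)
  have one: "\<one>\<^bsub>?M\<^esub> = ?c \<one>\<^bsub>?P\<^esub>" by (simp add: ultraproduct_def)
  have one_carr: "\<one>\<^bsub>?P\<^esub> \<in> carrier ?P" using mon by (auto simp: monoid.one_closed)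
  have assoc: "a \<otimes>\<^bsub>?P\<^esub> b \<otimes>\<^bsub>?P\<^esub> c = a \<otimes>\<^bsub>?P\<^esub> (b \<otimes>\<^bsub>?P\<^esub> c)"
    if "a \<in> carrier ?P" "b \<in> carrier ?P" "c \<in> carrier ?P" for a b c
    using that mon by (auto simp: PiE_iff monoid.m_assoc intro!: restrict_ext)
  have comm: "a \<otimes>\<^bsub>?P\<^esub> b = b \<otimes>\<^bsub>?P\<^esub> a" if "a \<in> carrier ?P" "b \<in> carrier ?P" for a b
    using that com by (auto simp: PiE_iff intro!: restrict_ext comm_monoid.m_comm)
  have l_one: "\<one>\<^bsub>?P\<^esub> \<otimes>\<^bsub>?P\<^esub> a = a" if "a \<in> carrier ?P" for a
    using that mon by (fastforce simp: PiE_iff monoid.l_one extensional_def)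
  have cancel: "?c a = ?c b"
    if "a \<in> carrier ?P" "b \<in> carrier ?P" "c \<in> carrier ?P"
      and e: "?c (a \<otimes>\<^bsub>?P\<^esub> c) = ?c (b \<otimes>\<^bsub>?P\<^esub> c)" for a b c
  proof -
    have "{i \<in> I. (a \<otimes>\<^bsub>?P\<^esub> c) i = (b \<otimes>\<^bsub>?P\<^esub> c) i} \<in> U"
      using e ultra_class_eq_iff[OF U closed[OF that(1,3)] closed[OF that(2,3)]] by simp
    moreover have "a i = b i" if "i \<in> I" "(a \<otimes>\<^bsub>?P\<^esub> c) i = (b \<otimes>\<^bsub>?P\<^esub> c) i" for i
    proof -
      interpret comm_monoid_cancel "H i" by (rule H[OF that(1)])
      show ?thesis
        using that \<open>a \<in> carrier ?P\<close> \<open>b \<in> carrier ?P\<close> \<open>c \<in> carrier ?P\<close>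
        by (intro r_cancel[of "a i" "c i" "b i"]) (auto simp: PiE_iff)
    qed
    ultimately have "{i \<in> I. a i = b i} \<in> U"
      by (elim ultrafilter_on_mono[OF U]) blast+
    then show ?thesis using ultra_class_eq_iff[OF U that(1,2)] by simp
  qed
  have "comm_monoid ?M"
  proof (rule comm_monoidI)
    fix x y assume "x \<in> carrier ?M" "y \<in> carrier ?M"
    then show "x \<otimes>\<^bsub>?M\<^esub> y \<in> carrier ?M"
      unfolding carr by (elim imageE) (simp only: mult closed imageI)
  next
    show "\<one>\<^bsub>?M\<^esub> \<in> carrier ?M" unfolding carr one using one_carr by (rule imageI)
  next
    fix x y z assume "x \<in> carrier ?M" "y \<in> carrier ?M" "z \<in> carrier ?M"
    then show "x \<otimes>\<^bsub>?M\<^esub> y \<otimes>\<^bsub>?M\<^esub> z = x \<otimes>\<^bsub>?M\<^esub> (y \<otimes>\<^bsub>?M\<^esub> z)"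
      unfolding carr by (elim imageE) (simp only: mult closed assoc)
  next
    fix x assume "x \<in> carrier ?M"
    then show "\<one>\<^bsub>?M\<^esub> \<otimes>\<^bsub>?M\<^esub> x = x"
      unfolding carr one by (elim imageE) (simp only: mult one_carr l_one)
  next
    fix x y assume "x \<in> carrier ?M" "y \<in> carrier ?M"
    then obtain a b where ab: "a \<in> carrier ?P" "b \<in> carrier ?P" "x = ?c a" "y = ?c b"
      unfolding carr by blast
    show "x \<otimes>\<^bsub>?M\<^esub> y = y \<otimes>\<^bsub>?M\<^esub> x"
      unfolding ab(3,4) mult[OF ab(1,2)] mult[OF ab(2,1)] comm[OF ab(1,2)] ..
  qed
  then show ?thesis
  proof (rule comm_monoid_cancelI)
    fix x y z
    assume e: "x \<otimes>\<^bsub>?M\<^esub> z = y \<otimes>\<^bsub>?M\<^esub> z"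
      and "x \<in> carrier ?M" "y \<in> carrier ?M" "z \<in> carrier ?M"
    then obtain a b c where abc: "a \<in> carrier ?P" "b \<in> carrier ?P" "c \<in> carrier ?P"
      "x = ?c a" "y = ?c b" "z = ?c c"
      unfolding carr by blast
    show "x = y"
      using e unfolding abc(4,5,6) mult[OF abc(1,3)] mult[OF abc(2,3)]
      by (rule cancel[OF abc(1,2,3)])
  qed
qed

end

(* For each k, the condition "a has at least k essentially different factorizations of length l"
   is first-order: it asks for k * l atoms, and being essentially the same is a finite disjunction
   over permutations. By Los' theorem it holds for the class of r in the ultraproduct iff it holds
   for r_i in H_i for U-almost all i. Both parts follow, since "= n" means "at least n, but not
   at least n + 1" and infinity means "at least k for all k". *)

theory Submission
  imports Defs
begin

section \<open>Factorization classes and units in a single monoid\<close>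

text \<open>Replaces the cardinality of a quotient by the existence of pairwise inequivalent
  representatives, the form that transfers to ultraproducts. Quantifiers over the finite set
  \<open>{..<k}\<close> can later be exchanged with \<open>eventually\<close>.\<close>

lemma (in comm_monoid_cancel) lengths_ge_iff:
  "enat k \<le> lengths G a l \<longleftrightarrow>
    (\<exists>f. (\<forall>p\<in>{..<k}. f p \<in> factorizations G a l) \<and>
      (\<forall>p\<in>{..<k}. \<forall>q\<in>{..<k}. p \<noteq> q \<longrightarrow> \<not> essentially_equal G (f p) (f q)))"
proof -
  let ?A = "factorizations G a l" and ?C = "factorization_classes G a l"
  let ?r = "{(us, vs). us \<in> ?A \<and> vs \<in> ?A \<and> essentially_equal G us vs}"
  have C: "?C = ?A // ?r" by (simp add: factorization_classes_def)
  note eqv = equiv_essentially_equal[of a l]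
  show ?thesis
    unfolding Ball_def lessThan_iff
  proof
    assume "enat k \<le> lengths G a l"
    \<comment> \<open>Infinitely many classes also contain a set of exactly \<open>k\<close>, so the
      finite and the infinite case need no separate treatment here.\<close>
    then obtain S where S: "S \<subseteq> ?C" "finite S" "card S = k"
      unfolding lengths_def
      by (metis enat_ord_simps(1) infinite_arbitrarily_large obtain_subset_with_card_n)
    then obtain h where h: "bij_betw h {..<k} S"
      using bij_betw_from_nat_into_finite lessThan_atLeast0 by metis
    have "\<exists>us. us \<in> h p" if "p < k" for p
      using that h S(1) in_quotient_imp_non_empty[OF eqv] C by (fastforce simp: bij_betw_def)
    then obtain f where f: "\<And>p. p < k \<Longrightarrow> f p \<in> h p" by metis
    have hC: "h p \<in> ?A // ?r" if "p < k" for p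
      using that h S(1) C by (auto simp: bij_betw_def)
    have fA: "f p \<in> ?A" if "p < k" for p
      using f[OF that] in_quotient_imp_subset[OF eqv hC[OF that]] by blast
    moreover have "\<not> essentially_equal G (f p) (f q)" if "p < k" "q < k" "p \<noteq> q" for p q
    proof
      assume "essentially_equal G (f p) (f q)"
      then have "(f p, f q) \<in> ?r" using fA that by blast
      then have "h p = h q"
        using quotient_eqI[OF eqv hC[OF that(1)] hC[OF that(2)] f[OF that(1)] f[OF that(2)]]
        by blast
      then show False using that h by (auto simp: bij_betw_def inj_on_def)
    qed
    ultimately show "\<exists>f. (\<forall>p<k. f p \<in> ?A) \<and>
         (\<forall>p<k. \<forall>q<k. p \<noteq> q \<longrightarrow> \<not> essentially_equal G (f p) (f q))" by blast
  next
    assume "\<exists>f. (\<forall>p<k. f p \<in> ?A) \<and>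
         (\<forall>p<k. \<forall>q<k. p \<noteq> q \<longrightarrow> \<not> essentially_equal G (f p) (f q))"
    then obtain f where f: "\<And>p. p < k \<Longrightarrow> f p \<in> ?A"
      and ne: "\<And>p q. p < k \<Longrightarrow> q < k \<Longrightarrow> p \<noteq> q \<Longrightarrow> \<not> essentially_equal G (f p) (f q)"
      by blast
    let ?g = "\<lambda>p. ?r `` {f p}"
    have "inj_on ?g {..<k}"
    proof (rule inj_onI)
      fix p q assume pq: "p \<in> {..<k}" "q \<in> {..<k}" "?g p = ?g q"
      then have pq: "p < k" "q < k" "?g p = ?g q" by simp_all
      have "(f p, f q) \<in> ?r"
        using pq(3) eq_equiv_class_iff[OF eqv f[OF pq(1)] f[OF pq(2)]] by (rule iffD1[rotated])
      then have "essentially_equal G (f p) (f q)" by simp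
      then show "p = q" using ne[OF pq(1,2)] by metis
    qed
    then have card: "card (?g ` {..<k}) = k"
      using card_image by fastforce
    have sub: "?g ` {..<k} \<subseteq> ?C"
      unfolding C using f quotientI[of _ ?A ?r] by blast
    \<comment> \<open>Only the finite case needs an argument: otherwise \<open>lengths\<close> is
      infinite and the bound is trivial.\<close>
    have "k \<le> card ?C" if "finite ?C"
      using card_mono[OF that sub] unfolding card .
    then show "enat k \<le> lengths G a l" by (simp add: lengths_def)
  qed
qed

text \<open>The disjunct with \<open>factors\<close> gives only the element one, which is itself a
  unit, so it is absorbed by the disjunct for units.\<close>

lemma (in monoid) Nil_in_factorizations_iff:
  "[] \<in> factorizations G a l \<longleftrightarrow> l = 0 \<and> a \<in> Units G"
  unfolding factorizations_def factors_def using Units_one_closed by auto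

lemma essentially_equal_imp_length_eq:
  assumes "essentially_equal G us vs"
  shows "length us = length vs"
  using assms by (metis essentially_equal_def list_all2_lengthD mset_eq_length)

text \<open>By commutativity a one-sided inverse suffices. This leaves one equation under one
  quantifier over the carrier, the shape that \<open>eventually_F_bex_carrier\<close>
  handles.\<close>

lemma (in comm_monoid) Units_iff:
  assumes "a \<in> carrier G"
  shows "a \<in> Units G \<longleftrightarrow> (\<exists>b\<in>carrier G. a \<otimes> b = \<one>)"
  using assms by (auto simp: Units_def m_comm)

section \<open>The ultrafilter as a filter, and the logical steps of Los' theorem\<close>

locale ultra =
  fixes I :: "'i set" and U :: "'i set set" and H :: "'i \<Rightarrow> ('a, 'm) monoid_scheme"
  assumes ultra: "ultrafilter_on I U"
    and cancel: "\<And>i. i \<in> I \<Longrightarrow> comm_monoid_cancel (H i)"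
begin

abbreviation "P \<equiv> product_group I H"
abbreviation "M \<equiv> ultraproduct I U H"
abbreviation "cls \<equiv> ultra_class I U H"
abbreviation "at_coord i \<equiv> map (\<lambda>u. u i)"

text \<open>With \<open>U\<close> recast as a filter on the whole index type, "for U-almost all i"
  becomes \<open>eventually\<close>, and its calculus is available.\<close>

definition "F = Abs_filter (\<lambda>Q. {i \<in> I. Q i} \<in> U)"

lemma eventually_F: "eventually Q F \<longleftrightarrow> {i \<in> I. Q i} \<in> U"
  unfolding F_def
proof (rule eventually_Abs_filter, unfold_locales)
  show "{i \<in> I. True} \<in> U" using ultra by (simp add: ultrafilter_on_def)
next
  fix Q R assume "{i \<in> I. Q i} \<in> U" "{i \<in> I. R i} \<in> U"
  then have "{i \<in> I. Q i} \<inter> {i \<in> I. R i} \<in> U" by (rule ultrafilter_on_Int[OF ultra])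
  then show "{i \<in> I. Q i \<and> R i} \<in> U" by (rule ultrafilter_on_mono[OF ultra]) auto
next
  fix Q R assume "\<forall>i. Q i \<longrightarrow> R i" "{i \<in> I. Q i} \<in> U"
  then show "{i \<in> I. R i} \<in> U" by (elim ultrafilter_on_mono[OF ultra]) auto
qed

lemma eventually_index: "eventually (\<lambda>i. i \<in> I) F"
  using ultra by (simp add: eventually_F ultrafilter_on_def)

text \<open>The monoid laws are assumed only for indices in \<open>I\<close>, so coordinatewise
  equivalences can be proved only there.\<close>

lemma eventually_F_cong:
  assumes "\<And>i. i \<in> I \<Longrightarrow> Q i \<longleftrightarrow> R i"
  shows "eventually Q F \<longleftrightarrow> eventually R F"
  unfolding eventually_F using assms by (metis (mono_tags, lifting) Collect_cong)

lemma eventually_F_const: "eventually (\<lambda>i. Q) F \<longleftrightarrow> Q"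
  using ultra by (cases Q) (auto simp: eventually_F ultrafilter_on_def)

text \<open>Negation in Los' theorem. One direction is the dichotomy that a set or its complement
  lies in \<open>U\<close>; the other holds because the empty set does not.\<close>

lemma not_eventually_F: "\<not> eventually Q F \<longleftrightarrow> eventually (\<lambda>i. \<not> Q i) F"
proof
  have "I - {i \<in> I. Q i} = {i \<in> I. \<not> Q i}" by auto
  moreover assume "\<not> eventually Q F"
  ultimately show "eventually (\<lambda>i. \<not> Q i) F"
    using ultra unfolding eventually_F ultrafilter_on_def by (metis (no_types, lifting) mem_Collect_eq subsetI)
next
  assume *: "eventually (\<lambda>i. \<not> Q i) F"
  show "\<not> eventually Q F"
  proof
    assume "eventually Q F"
    with * have "eventually (\<lambda>i. False) F" by eventually_elim auto
    then show False by (simp add: eventually_F_const)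
  qed
qed

text \<open>Finite disjunction, dual to finite conjunction through
  \<open>not_eventually_F\<close>.\<close>

lemma eventually_F_bex_finite:
  assumes "finite S"
  shows "eventually (\<lambda>i. \<exists>s\<in>S. Q i s) F \<longleftrightarrow> (\<exists>s\<in>S. eventually (\<lambda>i. Q i s) F)"
proof -
  have "\<not> eventually (\<lambda>i. \<exists>s\<in>S. Q i s) F \<longleftrightarrow> (\<forall>s\<in>S. \<not> eventually (\<lambda>i. Q i s) F)"
    unfolding not_eventually_F using eventually_ball_finite_distrib[OF assms] by simp
  then show ?thesis by blast
qed

text \<open>The existential quantifier in Los' theorem: witnesses chosen in the single coordinates
  form an element of the product.\<close>

lemma eventually_F_bex_carrier:
  "eventually (\<lambda>i. \<exists>x\<in>carrier (H i). Q i x) F \<longleftrightarrow>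
    (\<exists>a\<in>carrier P. eventually (\<lambda>i. Q i (a i)) F)"
proof
  assume ev: "eventually (\<lambda>i. \<exists>x\<in>carrier (H i). Q i x) F"
  \<comment> \<open>Where no witness exists, \<open>R\<close> accepts any element of the carrier,
    for instance one. Hence a choice is possible at every index of \<open>I\<close>, not only at
    almost all.\<close>
  define R where "R i x \<longleftrightarrow> x \<in> carrier (H i) \<and> ((\<exists>y\<in>carrier (H i). Q i y) \<longrightarrow> Q i x)" for i x
  have "\<exists>x. R i x" if "i \<in> I" for i
  proof -
    interpret comm_monoid_cancel "H i" by (rule cancel[OF that])
    show ?thesis unfolding R_def using one_closed by blast
  qed
  then obtain a where a: "\<And>i. i \<in> I \<Longrightarrow> R i (a i)" by metis
  have "restrict a I \<in> carrier P" using a by (simp add: R_def)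
  moreover have "eventually (\<lambda>i. Q i (restrict a I i)) F"
    using ev eventually_index by eventually_elim (use a R_def in auto)
  ultimately show "\<exists>a\<in>carrier P. eventually (\<lambda>i. Q i (a i)) F" by blast
next
  assume "\<exists>a\<in>carrier P. eventually (\<lambda>i. Q i (a i)) F"
  then obtain a where a: "a \<in> carrier P" "eventually (\<lambda>i. Q i (a i)) F" by blast
  from a(2) eventually_index show "eventually (\<lambda>i. \<exists>x\<in>carrier (H i). Q i x) F"
    by eventually_elim (use a(1) in auto)
qed

section \<open>Representatives and operations of the ultraproduct\<close>

sublocale ult: comm_monoid_cancel M
  using ultra cancel by (rule comm_monoid_cancel_ultraproduct)

lemma coord_closed: "a \<in> carrier P \<Longrightarrow> i \<in> I \<Longrightarrow> a i \<in> carrier (H i)"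
  by auto

lemma one_product_closed: "\<one>\<^bsub>P\<^esub> \<in> carrier P"
  using cancel by (auto intro!: monoid.one_closed comm_monoid.axioms(1) comm_monoid_cancel.axioms(2))

lemma mult_product_closed: "a \<in> carrier P \<Longrightarrow> b \<in> carrier P \<Longrightarrow> a \<otimes>\<^bsub>P\<^esub> b \<in> carrier P"
  using cancel by (rule product_mult_closed)

lemma carrier_ultraproduct: "carrier M = cls ` carrier P"
  by (auto simp: ultraproduct_def quotient_def ultra_class_def)

lemma cls_closed: "a \<in> carrier P \<Longrightarrow> cls a \<in> carrier M"
  by (simp only: carrier_ultraproduct imageI)

lemma one_ultraproduct: "\<one>\<^bsub>M\<^esub> = cls \<one>\<^bsub>P\<^esub>"
  by (simp add: ultraproduct_def)

lemma mult_cls: "a \<in> carrier P \<Longrightarrow> b \<in> carrier P \<Longrightarrow> cls a \<otimes>\<^bsub>M\<^esub> cls b = cls (a \<otimes>\<^bsub>P\<^esub> b)"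
  using ultra cancel by (rule ultraproduct_mult_class)

lemma cls_eq_iff:
  assumes "a \<in> carrier P" "b \<in> carrier P"
  shows "cls a = cls b \<longleftrightarrow> eventually (\<lambda>i. a i = b i) F"
  using ultra_class_eq_iff[OF ultra assms] by (simp add: eventually_F)

lemma lists_carrier_ultraproduct:
  assumes "set xs \<subseteq> carrier M"
  obtains us where "set us \<subseteq> carrier P" "xs = map cls us"
proof -
  have "xs \<in> lists (cls ` carrier P)"
    using assms by (simp only: carrier_ultraproduct lists_eq_set mem_Collect_eq)
  then have "xs \<in> map cls ` lists (carrier P)" by (simp only: lists_image)
  then show thesis using that unfolding lists_eq_set by blast
qed

section \<open>Transfer of units, atoms, associatedness and essential equality\<close>

text \<open>The pattern for the next lemmas: quantifiers over \<open>carrier M\<close> become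
  quantifiers over representatives in \<open>carrier P\<close>, the inner condition is transferred,
  and \<open>eventually_F_bex_carrier\<close> moves the quantifiers into the coordinates.\<close>

lemma Units_cls_iff:
  assumes a: "a \<in> carrier P"
  shows "cls a \<in> Units M \<longleftrightarrow> eventually (\<lambda>i. a i \<in> Units (H i)) F"
proof -
  have "cls a \<in> Units M \<longleftrightarrow> (\<exists>b\<in>carrier P. cls a \<otimes>\<^bsub>M\<^esub> cls b = \<one>\<^bsub>M\<^esub>)"
    unfolding ult.Units_iff[OF cls_closed[OF a]] by (simp only: carrier_ultraproduct bex_simps)
  also have "\<dots> \<longleftrightarrow> (\<exists>b\<in>carrier P. eventually (\<lambda>i. a i \<otimes>\<^bsub>H i\<^esub> b i = \<one>\<^bsub>H i\<^esub>) F)"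
    \<comment> \<open>The first simplification keeps the operations of \<open>P\<close> folded, so
      that the closure lemmas match; the second evaluates them at a coordinate.\<close>
    using a by (intro bex_cong refl)
      (simp add: mult_cls one_ultraproduct cls_eq_iff mult_product_closed one_product_closed
        cong: eventually_F_cong del: mult_product_group carrier_product_group one_product_group,
       simp cong: eventually_F_cong)
  also have "\<dots> \<longleftrightarrow> eventually (\<lambda>i. \<exists>y\<in>carrier (H i). a i \<otimes>\<^bsub>H i\<^esub> y = \<one>\<^bsub>H i\<^esub>) F"
    by (rule eventually_F_bex_carrier[symmetric])
  also have "\<dots> \<longleftrightarrow> eventually (\<lambda>i. a i \<in> Units (H i)) F"
    using comm_monoid.Units_iff[OF comm_monoid_cancel.axioms(2)[OF cancel]] coord_closed[OF a]
    by (intro eventually_F_cong) simp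
  finally show ?thesis .
qed

lemma cls_eq_mult_iff:
  assumes "a \<in> carrier P" "b \<in> carrier P" "c \<in> carrier P"
  shows "cls a = cls b \<otimes>\<^bsub>M\<^esub> cls c \<longleftrightarrow> eventually (\<lambda>i. a i = b i \<otimes>\<^bsub>H i\<^esub> c i) F"
  unfolding mult_cls[OF assms(2,3)] cls_eq_iff[OF assms(1) mult_product_closed[OF assms(2,3)]]
  by (rule eventually_F_cong) simp

text \<open>Splitting into two non-units is an existential condition, so it transfers by two uses of
  \<open>eventually_F_bex_carrier\<close>. An atom is a non-unit for which this fails, and
  \<open>not_eventually_F\<close> transfers the failure.\<close>

lemma irreducible_cls_iff:
  assumes a: "a \<in> carrier P"
  shows "irreducible M (cls a) \<longleftrightarrow> eventually (\<lambda>i. irreducible (H i) (a i)) F"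
proof -
  let ?Q = "\<lambda>i x y. a i = x \<otimes>\<^bsub>H i\<^esub> y \<and> x \<notin> Units (H i) \<and> y \<notin> Units (H i)"
  have "(\<exists>x\<in>carrier M. \<exists>y\<in>carrier M. cls a = x \<otimes>\<^bsub>M\<^esub> y \<and> x \<notin> Units M \<and> y \<notin> Units M) \<longleftrightarrow>
    (\<exists>b\<in>carrier P. \<exists>c\<in>carrier P.
      cls a = cls b \<otimes>\<^bsub>M\<^esub> cls c \<and> cls b \<notin> Units M \<and> cls c \<notin> Units M)"
    by (simp only: carrier_ultraproduct bex_simps)
  also have "\<dots> \<longleftrightarrow> (\<exists>b\<in>carrier P. \<exists>c\<in>carrier P. eventually (\<lambda>i. ?Q i (b i) (c i)) F)"
    using a by (intro bex_cong refl)
      (simp only: cls_eq_mult_iff Units_cls_iff not_eventually_F eventually_conj_iff)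
  also have "\<dots> \<longleftrightarrow> eventually (\<lambda>i. \<exists>x\<in>carrier (H i). \<exists>y\<in>carrier (H i). ?Q i x y) F"
    by (simp only: eventually_F_bex_carrier)
  finally have red: "\<not> (\<exists>x\<in>carrier M. \<exists>y\<in>carrier M. cls a = x \<otimes>\<^bsub>M\<^esub> y \<and> x \<notin> Units M \<and> y \<notin> Units M)
    \<longleftrightarrow> eventually (\<lambda>i. \<not> (\<exists>x\<in>carrier (H i). \<exists>y\<in>carrier (H i). ?Q i x y)) F"
    by (simp only: not_eventually_F)
  have "irreducible M (cls a) \<longleftrightarrow> cls a \<notin> Units M \<and>
      \<not> (\<exists>x\<in>carrier M. \<exists>y\<in>carrier M. cls a = x \<otimes>\<^bsub>M\<^esub> y \<and> x \<notin> Units M \<and> y \<notin> Units M)"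
    unfolding ult.irreducible_iff_atom[OF cls_closed[OF a]] by blast
  also have "\<dots> \<longleftrightarrow> eventually (\<lambda>i. a i \<notin> Units (H i) \<and>
      \<not> (\<exists>x\<in>carrier (H i). \<exists>y\<in>carrier (H i). ?Q i x y)) F"
    unfolding red by (simp only: Units_cls_iff[OF a] not_eventually_F eventually_conj_iff)
  also have "\<dots> \<longleftrightarrow> eventually (\<lambda>i. irreducible (H i) (a i)) F"
    using comm_monoid_cancel.irreducible_iff_atom[OF cancel coord_closed[OF a]]
    by (intro eventually_F_cong) blast
  finally show ?thesis .
qed

text \<open>The unit relating the two elements is quantified over the whole carrier, with
  invertibility as a conjunct, so that \<open>eventually_F_bex_carrier\<close> applies.\<close>

lemma associated_cls_iff:
  assumes a: "a \<in> carrier P" and b: "b \<in> carrier P"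
  shows "associated M (cls a) (cls b) \<longleftrightarrow> eventually (\<lambda>i. associated (H i) (a i) (b i)) F"
proof -
  have "associated M (cls a) (cls b) \<longleftrightarrow>
      (\<exists>x\<in>carrier M. x \<in> Units M \<and> cls a = x \<otimes>\<^bsub>M\<^esub> cls b)"
    unfolding ult.associated_iff_unit_mult[OF cls_closed[OF a] cls_closed[OF b]]
    using ult.Units_closed by blast
  also have "\<dots> \<longleftrightarrow> (\<exists>e\<in>carrier P. cls e \<in> Units M \<and> cls a = cls e \<otimes>\<^bsub>M\<^esub> cls b)"
    by (simp only: carrier_ultraproduct bex_simps)
  also have "\<dots> \<longleftrightarrow>
      (\<exists>e\<in>carrier P. eventually (\<lambda>i. e i \<in> Units (H i) \<and> a i = e i \<otimes>\<^bsub>H i\<^esub> b i) F)"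
    using a b by (intro bex_cong refl) (simp only: cls_eq_mult_iff Units_cls_iff eventually_conj_iff)
  also have "\<dots> \<longleftrightarrow>
      eventually (\<lambda>i. \<exists>x\<in>carrier (H i). x \<in> Units (H i) \<and> a i = x \<otimes>\<^bsub>H i\<^esub> b i) F"
    by (rule eventually_F_bex_carrier[symmetric])
  also have "\<dots> \<longleftrightarrow> eventually (\<lambda>i. associated (H i) (a i) (b i)) F"
  proof (rule eventually_F_cong)
    fix i assume i: "i \<in> I"
    interpret comm_monoid_cancel "H i" by (rule cancel[OF i])
    show "(\<exists>x\<in>carrier (H i). x \<in> Units (H i) \<and> a i = x \<otimes>\<^bsub>H i\<^esub> b i) \<longleftrightarrow>
        associated (H i) (a i) (b i)"
      unfolding associated_iff_unit_mult[OF coord_closed[OF a i] coord_closed[OF b i]]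
      using Units_closed by blast
  qed
  finally show ?thesis .
qed

text \<open>The matching permutation may vary with the coordinate, but only finitely many
  permutations of the positions exist, so one of them works for almost all coordinates.\<close>

lemma essentially_equal_cls_iff:
  assumes us: "set us \<subseteq> carrier P" and vs: "set vs \<subseteq> carrier P"
  shows "essentially_equal M (map cls us) (map cls vs) \<longleftrightarrow>
    eventually (\<lambda>i. essentially_equal (H i) (at_coord i us) (at_coord i vs)) F"
proof (cases "length us = length vs")
  case len: True
  let ?S = "{s. s permutes {..<length us}}"
  have sM: "set (map cls ws) \<subseteq> carrier M" if "set ws \<subseteq> carrier P" for ws
    using that cls_closed by auto
  have s_less: "s j < length vs" if "s \<in> ?S" "j < length us" for s j
    using that len permutes_in_image[of s "{..<length us}" j] by auto
  have nth: "us ! j \<in> carrier P" "vs ! s j \<in> carrier P" if "s \<in> ?S" "j < length us" for s j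
    using subsetD[OF us nth_mem] subsetD[OF vs nth_mem] that s_less by blast+
  have "essentially_equal M (map cls us) (map cls vs) \<longleftrightarrow>
      (\<exists>s\<in>?S. \<forall>j\<in>{..<length us}. associated M (cls (us ! j)) (cls (vs ! s j)))"
    unfolding ult.essentially_equal_iff_permutes[OF sM[OF us] sM[OF vs]]
    using len s_less by auto
  also have "\<dots> \<longleftrightarrow> (\<exists>s\<in>?S. \<forall>j\<in>{..<length us}.
      eventually (\<lambda>i. associated (H i) ((us ! j) i) ((vs ! s j) i)) F)"
    using associated_cls_iff nth by (intro bex_cong ball_cong refl) blast
  also have "\<dots> \<longleftrightarrow> eventually (\<lambda>i. \<exists>s\<in>?S. \<forall>j\<in>{..<length us}.
      associated (H i) ((us ! j) i) ((vs ! s j) i)) F"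
    by (simp only: eventually_F_bex_finite finite_permutations finite_lessThan
        eventually_ball_finite_distrib)
  also have "\<dots> \<longleftrightarrow>
      eventually (\<lambda>i. essentially_equal (H i) (at_coord i us) (at_coord i vs)) F"
  proof (rule eventually_F_cong)
    fix i assume i: "i \<in> I"
    interpret comm_monoid_cancel "H i" by (rule cancel[OF i])
    have "set (at_coord i ws) \<subseteq> carrier (H i)" if "set ws \<subseteq> carrier P" for ws
      using that coord_closed[OF _ i] by auto
    from essentially_equal_iff_permutes[OF this[OF us] this[OF vs]]
    show "(\<exists>s\<in>?S. \<forall>j\<in>{..<length us}. associated (H i) ((us ! j) i) ((vs ! s j) i)) \<longleftrightarrow>
        essentially_equal (H i) (at_coord i us) (at_coord i vs)"
      using len s_less by auto
  qed
  finally show ?thesis .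
next
  case False
  \<comment> \<open>With different lengths, essential equality fails in \<open>M\<close> and in
    every coordinate.\<close>
  have "\<not> essentially_equal M (map cls us) (map cls vs)"
    using False essentially_equal_imp_length_eq[of M "map cls us" "map cls vs"] by auto
  moreover have "\<not> essentially_equal (H i) (at_coord i us) (at_coord i vs)" for i
    using False essentially_equal_imp_length_eq[of "H i" "at_coord i us" "at_coord i vs"] by auto
  ultimately show ?thesis by (simp add: eventually_F_const)
qed

section \<open>Transfer of factorizations and of their number\<close>

text \<open>The product formed in \<open>P\<close> links the product in \<open>M\<close> with those
  in the coordinates. Closure is part of the induction because \<open>mult_cls\<close> requires
  it.\<close>

lemma foldr_cls:
  assumes "set us \<subseteq> carrier P"
  shows "foldr (\<otimes>\<^bsub>M\<^esub>) (map cls us) \<one>\<^bsub>M\<^esub> = cls (foldr (\<otimes>\<^bsub>P\<^esub>) us \<one>\<^bsub>P\<^esub>) \<and>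
    foldr (\<otimes>\<^bsub>P\<^esub>) us \<one>\<^bsub>P\<^esub> \<in> carrier P \<and>
    (\<forall>i\<in>I. foldr (\<otimes>\<^bsub>P\<^esub>) us \<one>\<^bsub>P\<^esub> i = foldr (\<otimes>\<^bsub>H i\<^esub>) (at_coord i us) \<one>\<^bsub>H i\<^esub>)"
  using assms
proof (induction us)
  case Nil
  have "\<one>\<^bsub>P\<^esub> i = \<one>\<^bsub>H i\<^esub>" if "i \<in> I" for i
    using that by simp
  then show ?case
    unfolding list.map foldr_Nil id_apply one_ultraproduct using one_product_closed by blast
next
  case (Cons u us)
  then have u: "u \<in> carrier P" and us: "set us \<subseteq> carrier P" by auto
  let ?w = "foldr (\<otimes>\<^bsub>P\<^esub>) us \<one>\<^bsub>P\<^esub>"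
  have IH: "foldr (\<otimes>\<^bsub>M\<^esub>) (map cls us) \<one>\<^bsub>M\<^esub> = cls ?w" "?w \<in> carrier P"
    "\<forall>i\<in>I. ?w i = foldr (\<otimes>\<^bsub>H i\<^esub>) (at_coord i us) \<one>\<^bsub>H i\<^esub>"
    using Cons.IH[OF us] by blast+
  have "(u \<otimes>\<^bsub>P\<^esub> ?w) i = u i \<otimes>\<^bsub>H i\<^esub> ?w i" if "i \<in> I" for i
    using that by simp
  then show ?case
    unfolding list.map foldr_Cons o_apply IH(1) mult_cls[OF u IH(2)]
    using mult_product_closed[OF u IH(2)] IH(3) by metis
qed

text \<open>The empty list is treated apart, since it factors every unit. For a nonempty list the
  condition is a finite conjunction: the length, an atom at each entry, and one equation for the
  product.\<close>

lemma factorizations_cls_iff: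
  assumes us: "set us \<subseteq> carrier P" and a: "a \<in> carrier P"
  shows "map cls us \<in> factorizations M (cls a) l \<longleftrightarrow>
    eventually (\<lambda>i. at_coord i us \<in> factorizations (H i) (a i) l) F"
proof (cases "us = []")
  case True
  have "map cls us \<in> factorizations M (cls a) l \<longleftrightarrow> l = 0 \<and> cls a \<in> Units M"
    by (simp only: True list.map ult.Nil_in_factorizations_iff)
  also have "\<dots> \<longleftrightarrow> eventually (\<lambda>i. l = 0 \<and> a i \<in> Units (H i)) F"
    by (simp only: Units_cls_iff[OF a] eventually_conj_iff eventually_F_const)
  also have "\<dots> \<longleftrightarrow> eventually (\<lambda>i. at_coord i us \<in> factorizations (H i) (a i) l) F"
  proof (rule eventually_F_cong)
    fix i assume i: "i \<in> I"
    interpret comm_monoid_cancel "H i" by (rule cancel[OF i])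
    show "l = 0 \<and> a i \<in> Units (H i) \<longleftrightarrow> at_coord i us \<in> factorizations (H i) (a i) l"
      by (simp only: True list.map Nil_in_factorizations_iff)
  qed
  finally show ?thesis .
next
  case False
  let ?w = "foldr (\<otimes>\<^bsub>P\<^esub>) us \<one>\<^bsub>P\<^esub>"
  note w = foldr_cls[OF us]
  have "map cls us \<in> factorizations M (cls a) l \<longleftrightarrow>
      length us = l \<and> (\<forall>u\<in>set us. irreducible M (cls u)) \<and> cls ?w = cls a"
    using False us w cls_closed by (auto simp: factorizations_def factors_def)
  also have "\<dots> \<longleftrightarrow> length us = l \<and>
      (\<forall>u\<in>set us. eventually (\<lambda>i. irreducible (H i) (u i)) F) \<and> eventually (\<lambda>i. ?w i = a i) F"
    using irreducible_cls_iff us cls_eq_iff[of ?w a] a w by blast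
  also have "\<dots> \<longleftrightarrow> eventually (\<lambda>i. length us = l \<and>
      (\<forall>u\<in>set us. irreducible (H i) (u i)) \<and> ?w i = a i) F"
    by (simp only: eventually_conj_iff eventually_F_const eventually_ball_finite_distrib
        finite_set)
  also have "\<dots> \<longleftrightarrow> eventually (\<lambda>i. at_coord i us \<in> factorizations (H i) (a i) l) F"
  proof (rule eventually_F_cong)
    fix i assume i: "i \<in> I"
    have "set (at_coord i us) \<subseteq> carrier (H i)" using us coord_closed[OF _ i] by auto
    then show "length us = l \<and> (\<forall>u\<in>set us. irreducible (H i) (u i)) \<and> ?w i = a i \<longleftrightarrow>
        at_coord i us \<in> factorizations (H i) (a i) l"
      using False w i by (auto simp: factorizations_def factors_def)
  qed
  finally show ?thesis .
qed

lemma lengths_ge_cls_iff: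
  assumes a: "a \<in> carrier P"
  shows "enat k \<le> lengths M (cls a) l \<longleftrightarrow> eventually (\<lambda>i. enat k \<le> lengths (H i) (a i) l) F"
    (is "?L \<longleftrightarrow> ?R")
proof -
  let ?D = "\<lambda>N x f. (\<forall>p\<in>{..<k}. f p \<in> factorizations N x l) \<and>
    (\<forall>p\<in>{..<k}. \<forall>q\<in>{..<k}. p \<noteq> q \<longrightarrow> \<not> essentially_equal N (f p) (f q))"
  have ge_H: "enat k \<le> lengths (H i) (a i) l \<longleftrightarrow> (\<exists>f. ?D (H i) (a i) f)" if "i \<in> I" for i
    using comm_monoid_cancel.lengths_ge_iff[OF cancel[OF that]] .
  \<comment> \<open>For a fixed family of lists over \<open>P\<close> the condition is a finite
    conjunction of transferable statements. What remains is to pass from arbitrary families to such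
    lists, on either side.\<close>
  have transfer: "((\<forall>p\<in>{..<k}. map cls (g p) \<in> factorizations M (cls a) l) \<and>
      (\<forall>p\<in>{..<k}. \<forall>q\<in>{..<k}. p \<noteq> q \<longrightarrow>
        \<not> essentially_equal M (map cls (g p)) (map cls (g q)))) \<longleftrightarrow>
      eventually (\<lambda>i. ?D (H i) (a i) (\<lambda>p. at_coord i (g p))) F"
    if g: "\<And>p. p < k \<Longrightarrow> set (g p) \<subseteq> carrier P" for g
  proof -
    have "eventually (\<lambda>i. p \<noteq> q \<longrightarrow>
        \<not> essentially_equal (H i) (at_coord i (g p)) (at_coord i (g q))) F \<longleftrightarrow>
        (p \<noteq> q \<longrightarrow> \<not> essentially_equal M (map cls (g p)) (map cls (g q)))"
      if "p < k" "q < k" for p q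
      using essentially_equal_cls_iff[OF g[OF that(1)] g[OF that(2)]]
      by (cases "p = q") (simp_all add: not_eventually_F)
    then show ?thesis
      using factorizations_cls_iff[OF g a]
      by (simp add: eventually_conj_iff eventually_ball_finite_distrib)
  qed
  show ?thesis
  proof
    assume ?L
    then obtain f where f: "?D M (cls a) f"
      unfolding ult.lengths_ge_iff by blast
    \<comment> \<open>Each entry of a factorization in \<open>M\<close> is replaced by a
      representative in \<open>P\<close>.\<close>
    have "\<exists>us. set us \<subseteq> carrier P \<and> f p = map cls us" if "p < k" for p
    proof -
      have "set (f p) \<subseteq> carrier M" using f that by (simp add: factorizations_def)
      then show ?thesis by (rule lists_carrier_ultraproduct) blast
    qed
    then obtain g where g: "\<And>p. p < k \<Longrightarrow> set (g p) \<subseteq> carrier P"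
      and fg: "\<And>p. p < k \<Longrightarrow> f p = map cls (g p)" by metis
    have "?D M (cls a) (\<lambda>p. map cls (g p))"
      using f fg by (metis lessThan_iff)
    then have "eventually (\<lambda>i. ?D (H i) (a i) (\<lambda>p. at_coord i (g p))) F"
      by (rule transfer[of g, THEN iffD1, rotated]) (rule g)
    with eventually_index show ?R
    proof eventually_elim
      case (elim i)
      show ?case unfolding ge_H[OF elim(1)]
        using elim(2) by (rule exI[where x = "\<lambda>p. at_coord i (g p)"])
    qed
  next
    assume ?R
    then have "eventually (\<lambda>i. \<exists>f. ?D (H i) (a i) f) F"
      by (subst (asm) eventually_F_cong[OF ge_H])
    \<comment> \<open>\<open>eventually_ex\<close> chooses a family for each coordinate, so
      \<open>f\<close> takes the index \<open>i\<close> as its first argument.\<close>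
    then obtain f where f: "eventually (\<lambda>i. ?D (H i) (a i) (f i)) F"
      unfolding eventually_ex by blast
    \<comment> \<open>\<open>g\<close> interchanges the roles of coordinate and position: entry
      \<open>j\<close> of \<open>g p\<close> collects the \<open>j\<close>-th atoms of the lists
      \<open>f i p\<close> over all \<open>i\<close>. The default one keeps it in the product at
      coordinates where \<open>f i p\<close> is not a factorization.\<close>
    define g where "g p = map (\<lambda>j. \<lambda>i\<in>I.
      if f i p \<in> factorizations (H i) (a i) l then f i p ! j else \<one>\<^bsub>H i\<^esub>) [0..<l]" for p
    have g_closed: "set (g p) \<subseteq> carrier P" if "p < k" for p
    proof -
      have "(if f i p \<in> factorizations (H i) (a i) l then f i p ! j else \<one>\<^bsub>H i\<^esub>) \<in> carrier (H i)"
        if "i \<in> I" "j < l" for i j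
      proof -
        interpret comm_monoid_cancel "H i" by (rule cancel[OF that(1)])
        show ?thesis using that(2) nth_mem by (fastforce simp: factorizations_def)
      qed
      then show ?thesis by (auto simp: g_def)
    qed
    have "eventually (\<lambda>i. ?D (H i) (a i) (\<lambda>p. at_coord i (g p))) F"
      using f eventually_index
    proof eventually_elim
      case (elim i)
      \<comment> \<open>At a coordinate where \<open>f\<close> succeeds the default is not taken,
        and the common length \<open>l\<close> lets \<open>g\<close> recover the whole list.\<close>
      have "at_coord i (g p) = f i p" if "p < k" for p
      proof -
        have fp: "f i p \<in> factorizations (H i) (a i) l" using elim that by simp
        then have "length (f i p) = l" by (simp add: factorizations_def)
        with fp elim(2) show ?thesis by (intro nth_equalityI) (simp_all add: g_def)
      qed
      with elim(1) show ?case by simp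
    qed
    then have "?D M (cls a) (\<lambda>p. map cls (g p))"
      by (rule transfer[of g, THEN iffD2, rotated]) (rule g_closed)
    then show ?L
      unfolding ult.lengths_ge_iff by (rule exI[where x = "\<lambda>p. map cls (g p)"])
  qed
qed

end

section \<open>From lower bounds to exact and infinite multiplicities\<close>

lemma enat_eq_iff_ge: "x = enat n \<longleftrightarrow> enat n \<le> x \<and> \<not> enat (Suc n) \<le> x"
  by (cases x) auto

lemma enat_eq_infinity_iff: "x = \<infinity> \<longleftrightarrow> (\<forall>m\<ge>1. enat m < x)"
proof (cases x)
  case (enat k)
  \<comment> \<open>\<open>Suc k\<close> refutes the right-hand side for a finite value
    \<open>k\<close>; it is at least 1 even when \<open>k\<close> is 0.\<close>
  then show ?thesis by (auto intro!: exI[of _ "Suc k"])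
qed auto

theorem theorem1:
  fixes \<Lambda> :: "'i set"
    and H :: "'i \<Rightarrow> ('a, 'm) monoid_scheme"
    and U :: "'i set set"
    and r :: "'i \<Rightarrow> 'a"
    and l n :: nat
  assumes "\<And>i. i \<in> \<Lambda> \<Longrightarrow> comm_monoid_cancel (H i)"
    and "ultrafilter_on \<Lambda> U"
    and "r \<in> carrier (product_group \<Lambda> H)"
  shows "(lengths (ultraproduct \<Lambda> U H) (ultra_class \<Lambda> U H r) l = enat n \<longleftrightarrow>
            {i \<in> \<Lambda>. lengths (H i) (r i) l = enat n} \<in> U) \<and>
         (lengths (ultraproduct \<Lambda> U H) (ultra_class \<Lambda> U H r) l = \<infinity> \<longleftrightarrow>
            (\<forall>m::nat. m \<ge> 1 \<longrightarrow> {i \<in> \<Lambda>. lengths (H i) (r i) l > enat m} \<in> U))"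
proof -
  interpret ultra \<Lambda> U H by (rule ultra.intro) (fact assms)+
  have "lengths M (cls r) l = enat n \<longleftrightarrow> eventually (\<lambda>i. lengths (H i) (r i) l = enat n) F"
    unfolding enat_eq_iff_ge
    by (simp only: lengths_ge_cls_iff[OF assms(3)] not_eventually_F eventually_conj_iff)
  moreover have "lengths M (cls r) l = \<infinity> \<longleftrightarrow>
      (\<forall>m\<ge>1. eventually (\<lambda>i. enat m < lengths (H i) (r i) l) F)"
    \<comment> \<open>Exceeding \<open>m\<close> means being at least \<open>Suc m\<close>, which
      brings the strict bounds under \<open>lengths_ge_cls_iff\<close>.\<close>
    unfolding enat_eq_infinity_iff
    by (simp only: Suc_ile_eq[symmetric] lengths_ge_cls_iff[OF assms(3)])
  ultimately show ?thesis by (simp add: eventually_F)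
qed

end
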